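(* For $i=1,2$ let $(\mathfrak P^{(i)},\mathfrak T^{(i)},\mathfrak e^{(i)})$ be a state system with measurements (as defined in the context), with poset of states $\mathfrak S^{(i)}$ in which every pure state is maximal, let $\mathfrak U^{(i)}$ be a scheme of discriminating generalized yes/no tests on $\mathfrak S^{(i)}$, and let $\mathcal C(\mathfrak S^{(i)}_{pure})$ be the ortho-lattice of ortho-closed sets of pure states. Let $(\widetilde f,f^\ast)$ be a symmetry from $(\mathfrak S^{(1)},\mathfrak T^{(1)},\widetilde{\mathfrak e}^{(1)})$ to $(\mathfrak S^{(2)},\mathfrak T^{(2)},\widetilde{\mathfrak e}^{(2)})$ preserving the schemes, $f^\ast(\mathfrak U^{(2)})=\mathfrak U^{(1)}$. Then the map $$\underline{\widetilde f}:\mathcal C(\mathfrak S^{(1)}_{pure})\to\mathcal C(\mathfrak S^{(2)}_{pure}),\qquad \underline{\widetilde f}(\mathfrak c)=\bigvee_{\sigma\in\mathfrak c}\{\widetilde f(\sigma)\}$$ (the join being computed in $\mathcal C(\mathfrak S^{(2)}_{pure})$) is injective, preserves suprema, maps atoms to atoms, and preserves orthogonality, i.e. $\underline{\widetilde f}(\mathfrak c^{\underline\perp})=(\underline{\widetilde f}(\mathfrak c))^{\underline\perp}$ for all $\mathfrak c\in\mathcal C(\mathfrak S^{(1)}_{pure})$. It is thus an ortho-morphism of Hilbert lattices.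
   Context: Let $\mathfrak B=\{\bot,\mathbf Y,\mathbf N\}$ with partial order $u\le v$ iff $u=\bot$ or $u=v$, and involution $\overline{\bot}=\bot$, $\overline{\mathbf Y}=\mathbf N$, $\overline{\mathbf N}=\mathbf Y$. The data are: sets $\mathfrak P$ and $\mathfrak T$ (yes/no tests), a map $\mathfrak e:\mathfrak P\times\mathfrak T\to\mathfrak B$, a map $\mathfrak t\mapsto\overline{\mathfrak t}$ on $\mathfrak T$ with $\mathfrak e(\mathfrak p,\overline{\mathfrak t})=\overline{\mathfrak e(\mathfrak p,\mathfrak t)}$, and, with $\mathfrak A_{\mathfrak t}=\{\mathfrak p\mid\mathfrak e(\mathfrak p,\mathfrak t)=\mathbf Y\}$, $\mathfrak Q_{\mathfrak t}=\{\mathfrak p\mid\mathfrak e(\mathfrak p,\mathfrak t)\le\mathbf Y\}$: measurement maps $\mathfrak Q_{\mathfrak t}\to\mathfrak P$, $\mathfrak p\mapsto\mathfrak p\cdot\mathfrak t$; and an associative succession $\mathfrak t_1\cdot\mathfrak t_2\in\mathfrak T$ with $\mathfrak A_{\mathfrak t_1\cdot\mathfrak t_2}=\{\mathfrak p\in\mathfrak A_{\mathfrak t_1}\mid\mathfrak p\cdot\mathfrak t_1\in\mathfrak A_{\mathfrak t_2}\}$, $\mathfrak Q_{\mathfrak t_1\cdot\mathfrak t_2}=\{\mathfrak p\in\mathfrak Q_{\mathfrak t_1}\mid\mathfrak p\cdot\mathfrak t_1\in\mathfrak Q_{\mathfrak t_2}\}$, $\mathfrak A_{\overline{\mathfrak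 t_1\cdot\mathfrak t_2}}=\mathfrak A_{\overline{\mathfrak t_1}}\cup\{\mathfrak p\in\mathfrak Q_{\mathfrak t_1}\mid\mathfrak p\cdot\mathfrak t_1\in\mathfrak A_{\overline{\mathfrak t_2}}\}$, $\mathfrak p\cdot(\mathfrak t_1\cdot\mathfrak t_2)=(\mathfrak p\cdot\mathfrak t_1)\cdot\mathfrak t_2$. Put $\mathfrak p_1\sim\mathfrak p_2$ iff $\mathfrak e(\mathfrak p_1,\mathfrak t)=\mathfrak e(\mathfrak p_2,\mathfrak t)$ for all $\mathfrak t$; $\mathfrak S=\mathfrak P/\sim$ (states), $\lceil\mathfrak p\rceil$ the class of $\mathfrak p$, $\widetilde{\mathfrak e}_{\mathfrak t}(\lceil\mathfrak p\rceil)=\mathfrak e(\mathfrak p,\mathfrak t)$, $\lceil\mathfrak p\rceil\cdot\mathfrak t=\lceil\mathfrak p\cdot\mathfrak t\rceil$ (well defined), and $\sigma_1\sqsubseteq\sigma_2$ iff $\widetilde{\mathfrak e}_{\mathfrak t}(\sigma_1)\le\widetilde{\mathfrak e}_{\mathfrak t}(\sigma_2)$ for all $\mathfrak t$. $\sqcap,\inf,\sqcup,\bigsqcup$ are infima and suprema in $\mathfrak S$; $\sqsubset$ is strict order; $\sigma\lessdot\tau$ means $\tau$ covers $\sigma$. A state system with measurements is such data satisfying: (A1) for every nonempty $P\subseteq\mathfrak P$ there is a unique element of $\mathfrak P$, denoted $\inf P$, with $\mathfrak e(\inf P,\mathfrak t)=\bigwedge_{\mathfrak p\in P}\mathfrak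 e(\mathfrak p,\mathfrak t)$ for all $\mathfrak t$; (A2) there is a unique $\mathfrak p_\bot$ with $\mathfrak e(\mathfrak p_\bot,\mathfrak t)=\bot$ for all $\mathfrak t$ (its class $\bot$ is the bottom of $\mathfrak S$); (A3) every nonempty chain in $\mathfrak S$ has a supremum; (A4) if $\widetilde{\mathfrak e}_{\mathfrak t}(\bigsqcup\mathfrak C)=\mathbf Y$ for a nonempty chain $\mathfrak C$ then $\widetilde{\mathfrak e}_{\mathfrak t}(\sigma)=\mathbf Y$ for some $\sigma\in\mathfrak C$; (A5) if $\sigma\sqsubset\sigma'$ there is $\sigma''$ with $\sigma\lessdot\sigma''\sqsubseteq\sigma'$; (A6) (a) if $\sigma_1\sqsubseteq\sigma_2\sqsubseteq\sigma_2'$ there is $\sigma_1'$ with $\sigma_1=\sigma_1'\sqcap\sigma_2$, $\sigma_2'=\sigma_1'\sqcup\sigma_2$; (b) if $\sigma_1'\sqsubseteq\sigma_2'$, $\sigma_2\lessdot\sigma_2'$, $\sigma_1'\not\sqsubseteq\sigma_2$, then $(\sigma_1'\sqcap\sigma_2)\lessdot\sigma_1'$; (c) if $\sigma_1\sqsubseteq\sigma_1'\sqsubseteq\sigma_2'$, $\sigma_1\lessdot\sigma_2\sqsubseteq\sigma_2'$, $\sigma_2\not\sqsubseteq\sigma_1'$, then $\sigma_1'\lessdot(\sigma_1'\sqcup\sigma_2)$. A state $\sigma$ is pure ($\sigma\in\mathfrak S_{pure}$) if for nonempty $S\subseteq\mathfrak S$, $\sigma=\inf S$ implies $\sigma\in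 S$. States are consistent if they have a common upper bound. A generalized yes/no test is a pair $\mathfrak t_{(\Sigma,\Sigma')}$ of inconsistent states, with evaluation $\widetilde{\mathfrak e}_{\mathfrak t_{(\Sigma,\Sigma')}}(\sigma)=\mathbf Y$ if $\Sigma\sqsubseteq\sigma$, $\mathbf N$ if $\Sigma'\sqsubseteq\sigma$, $\bot$ otherwise; its conjugate is $\mathfrak t_{(\Sigma',\Sigma)}$. It is discriminating if moreover $\Sigma$ is consistent with every $x\sqsubset\Sigma'$ and $\Sigma'$ with every $x\sqsubset\Sigma$. A scheme is a set $\mathfrak U$ of generalized tests which is complete (for each $\Sigma\ne\bot$ there is $\Sigma'$ with $\mathfrak t_{(\Sigma,\Sigma')}\in\mathfrak U$), irredundant (for $\mathfrak t_{(\Sigma_1,\Sigma_1')},\mathfrak t_{(\Sigma_2,\Sigma_2')}\in\mathfrak U$: $\Sigma_1\sqsubseteq\Sigma_2\Leftrightarrow\Sigma_2'\sqsubseteq\Sigma_1'$) and closed (stable under conjugation, and under $(\mathfrak t_{(\Sigma_1,\Sigma_1')},\mathfrak t_{(\Sigma_2,\Sigma_2')})\mapsto\mathfrak t_{(\Sigma_1\sqcup\Sigma_2,\Sigma_1'\sqcap\Sigma_2')}$ when $\Sigma_1,\Sigma_2$ are consistent). For $\sigma_1,\sigma_2\ne\bot$: $\sigma_1\perp\sigma_2$ iff there is $\mathfrak t_{(\Sigma,\Sigma')}\in\mathfrak U$ with $\Sigma\sqsubseteq\sigma_1$, $\Sigma'\sqsubseteq\sigma_2$. $\underline\perp$ is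 the restriction of $\perp$ to $\mathfrak S_{pure}$; for $S\subseteq\mathfrak S_{pure}$, $S^{\underline\perp}=\{\sigma'\in\mathfrak S_{pure}\mid\forall\sigma\in S,\ \sigma\underline\perp\sigma'\}$; $\mathcal C(\mathfrak S_{pure})=\{\mathfrak c\subseteq\mathfrak S_{pure}\mid\mathfrak c^{\underline\perp\underline\perp}=\mathfrak c\}$ ordered by inclusion, with joins $\bigvee_j\mathfrak c_j=(\bigcup_j\mathfrak c_j)^{\underline\perp\underline\perp}$; its atoms are the singletons of pure states. A symmetry is a pair $\widetilde f:\mathfrak S^{(1)}\to\mathfrak S^{(2)}$, $f^\ast:\mathfrak T^{(2)}\to\mathfrak T^{(1)}$ with: $\widetilde{\mathfrak e}^{(2)}_{\mathfrak t}(\widetilde f(\sigma))=\widetilde{\mathfrak e}^{(1)}_{f^\ast(\mathfrak t)}(\sigma)$; $\widetilde f(\sigma)\cdot\mathfrak t=\widetilde f(\sigma\cdot f^\ast(\mathfrak t))$ when defined; $f^\ast(\mathfrak t\cdot\mathfrak t')=f^\ast(\mathfrak t)\cdot f^\ast(\mathfrak t')$; $\widetilde f$ injective; $f^\ast$ surjective. The map $f^\ast$ is also defined on the generalized tests in $\mathfrak U^{(2)}$, where it satisfies the same identity $\widetilde{\mathfrak e}^{(2)}_{\mathfrak u}(\widetilde f(\sigma))=\widetilde{\mathfrak e}^{(1)}_{f^\ast(\mathfrak u)}(\sigma)$. That $\widetilde f$ sends pure states to pure states (so that the formula for $\underline{\widetilde f}$ makes sense) is part of the assertion. An ortho-morphism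 of Hilbert lattices is here a map preserving arbitrary suprema, mapping atoms to atoms, and satisfying $\varphi(\mathfrak c^{\perp})=\varphi(\mathfrak c)^{\perp}$. *)

theory Defs
  imports "HOL-Algebra.Complete_Lattice"
begin

section \<open>Truth values\<close>

datatype verdict = Undet | Yes | No

instantiation verdict :: order
begin

definition less_eq_verdict :: "verdict \<Rightarrow> verdict \<Rightarrow> bool"
  where "u \<le> v \<longleftrightarrow> u = Undet \<or> u = v"

definition less_verdict :: "verdict \<Rightarrow> verdict \<Rightarrow> bool"
  where "u < v \<longleftrightarrow> u \<le> v \<and> \<not> v \<le> (u :: verdict)"

instance
  by standard (auto simp: less_eq_verdict_def less_verdict_def)

end

fun neg :: "verdict \<Rightarrow> verdict"
  where
    "neg Undet = Undet"
  | "neg Yes = No"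
  | "neg No = Yes"


section \<open>Order-theoretic notions on a poset\<close>

text \<open>
  Posets are \<^typ>\<open>'a gorder\<close> records. The operators \<^term>\<open>x \<squnion>\<^bsub>L\<^esub> y\<close>, \<^term>\<open>x \<sqinter>\<^bsub>L\<^esub> y\<close>,
  \<^term>\<open>\<Squnion>\<^bsub>L\<^esub>A\<close> and \<^term>\<open>\<bottom>\<^bsub>L\<^esub>\<close> are unspecified when the bound does not exist; they are used
  below only where it does.
\<close>

definition covers :: "('a, 'b) gorder_scheme \<Rightarrow> 'a \<Rightarrow> 'a \<Rightarrow> bool"  (infixl \<open>\<lessdot>\<index>\<close> 50)
  where "x \<lessdot>\<^bsub>L\<^esub> y \<longleftrightarrow> x \<in> carrier L \<and> y \<in> carrier L \<and> x \<sqsubset>\<^bsub>L\<^esub> y \<and>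
           \<not> (\<exists>z\<in>carrier L. x \<sqsubset>\<^bsub>L\<^esub> z \<and> z \<sqsubset>\<^bsub>L\<^esub> y)"

definition consistent :: "('a, 'b) gorder_scheme \<Rightarrow> 'a \<Rightarrow> 'a \<Rightarrow> bool"
  where "consistent L x y \<longleftrightarrow> (\<exists>z\<in>carrier L. x \<sqsubseteq>\<^bsub>L\<^esub> z \<and> y \<sqsubseteq>\<^bsub>L\<^esub> z)"

definition pure :: "('a, 'b) gorder_scheme \<Rightarrow> 'a set"
  where "pure L = {x \<in> carrier L. \<forall>A. A \<subseteq> carrier L \<and> A \<noteq> {} \<and> is_glb L x A \<longrightarrow> x \<in> A}"

definition maximal_elements :: "('a, 'b) gorder_scheme \<Rightarrow> 'a set"
  where "maximal_elements L = {x \<in> carrier L. \<forall>y\<in>carrier L. x \<sqsubseteq>\<^bsub>L\<^esub> y \<longrightarrow> y = x}"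


section \<open>State systems with measurements\<close>

record ('p, 't) test_system =
  Prep :: "'p set"
  Test :: "'t set"
  ev :: "'p \<Rightarrow> 't \<Rightarrow> verdict"
  bar :: "'t \<Rightarrow> 't"
  meas :: "'p \<Rightarrow> 't \<Rightarrow> 'p"
  succession :: "'t \<Rightarrow> 't \<Rightarrow> 't"

definition yes_set :: "('p, 't) test_system \<Rightarrow> 't \<Rightarrow> 'p set"
  where "yes_set M t = {p \<in> Prep M. ev M p t = Yes}"

definition maybe_set :: "('p, 't) test_system \<Rightarrow> 't \<Rightarrow> 'p set"
  where "maybe_set M t = {p \<in> Prep M. ev M p t \<le> Yes}"

definition state_eq :: "('p, 't) test_system \<Rightarrow> ('p \<times> 'p) set"
  where "state_eq M = {(p, q). p \<in> Prep M \<and> q \<in> Prep M \<and> (\<forall>t\<in>Test M. ev M p t = ev M q t)}"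

definition state_of :: "('p, 't) test_system \<Rightarrow> 'p \<Rightarrow> 'p set"
  where "state_of M p = state_eq M `` {p}"

definition states :: "('p, 't) test_system \<Rightarrow> 'p set set"
  where "states M = Prep M // state_eq M"

text \<open>
  The evaluation and the measurement of a state are read off from any representative; see the
  lemmas \<open>state_ev_state_of\<close> and \<open>state_meas_state_of\<close> below.
\<close>

definition state_ev :: "('p, 't) test_system \<Rightarrow> 't \<Rightarrow> 'p set \<Rightarrow> verdict"
  where "state_ev M t \<sigma> = the_elem ((\<lambda>p. ev M p t) ` \<sigma>)"

definition state_meas :: "('p, 't) test_system \<Rightarrow> 'p set \<Rightarrow> 't \<Rightarrow> 'p set"
  where "state_meas M \<sigma> t = the_elem ((\<lambda>p. state_of M (meas M p t)) ` \<sigma>)"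

definition state_poset :: "('p, 't) test_system \<Rightarrow> 'p set gorder"
  where "state_poset M =
    \<lparr> carrier = states M, eq = (=),
      le = (\<lambda>\<sigma> \<tau>. \<forall>t\<in>Test M. state_ev M t \<sigma> \<le> state_ev M t \<tau>) \<rparr>"

locale measurement_data =
  fixes M :: "('p, 't) test_system"
  assumes bar_closed: "t \<in> Test M \<Longrightarrow> bar M t \<in> Test M"
    and ev_bar: "\<lbrakk>p \<in> Prep M; t \<in> Test M\<rbrakk> \<Longrightarrow> ev M p (bar M t) = neg (ev M p t)"
    and meas_closed: "\<lbrakk>t \<in> Test M; p \<in> maybe_set M t\<rbrakk> \<Longrightarrow> meas M p t \<in> Prep M"
    and succession_closed:
      "\<lbrakk>t \<in> Test M; u \<in> Test M\<rbrakk> \<Longrightarrow> succession M t u \<in> Test M"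
    and succession_assoc:
      "\<lbrakk>t \<in> Test M; u \<in> Test M; v \<in> Test M\<rbrakk> \<Longrightarrow>
        succession M (succession M t u) v = succession M t (succession M u v)"
    and yes_succession:
      "\<lbrakk>t \<in> Test M; u \<in> Test M\<rbrakk> \<Longrightarrow>
        yes_set M (succession M t u) = {p \<in> yes_set M t. meas M p t \<in> yes_set M u}"
    and maybe_succession:
      "\<lbrakk>t \<in> Test M; u \<in> Test M\<rbrakk> \<Longrightarrow>
        maybe_set M (succession M t u) = {p \<in> maybe_set M t. meas M p t \<in> maybe_set M u}"
    and yes_bar_succession:
      "\<lbrakk>t \<in> Test M; u \<in> Test M\<rbrakk> \<Longrightarrow>
        yes_set M (bar M (succession M t u)) =
          yes_set M (bar M t) \<union> {p \<in> maybe_set M t. meas M p t \<in> yes_set M (bar M u)}"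
    and meas_succession:
      "\<lbrakk>t \<in> Test M; u \<in> Test M; p \<in> maybe_set M (succession M t u)\<rbrakk> \<Longrightarrow>
        meas M p (succession M t u) = meas M (meas M p t) u"

locale state_system = measurement_data M for M :: "('p, 't) test_system" +
  fixes L (structure)
  defines "L \<equiv> state_poset M"
  assumes A1: "\<lbrakk>P \<subseteq> Prep M; P \<noteq> {}\<rbrakk> \<Longrightarrow>
      \<exists>!p. p \<in> Prep M \<and> (\<forall>t\<in>Test M. ev M p t = (GREATEST v. \<forall>q\<in>P. v \<le> ev M q t))"
    and A2: "\<exists>!p. p \<in> Prep M \<and> (\<forall>t\<in>Test M. ev M p t = Undet)"
    and A3: "\<lbrakk>C \<subseteq> states M; C \<noteq> {}; Complete_Partial_Order.chain (\<sqsubseteq>) C\<rbrakk> \<Longrightarrow>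
      \<exists>\<sigma>. is_lub L \<sigma> C"
    and A4: "\<lbrakk>C \<subseteq> states M; C \<noteq> {}; Complete_Partial_Order.chain (\<sqsubseteq>) C; t \<in> Test M;
        state_ev M t (\<Squnion>C) = Yes\<rbrakk> \<Longrightarrow> \<exists>\<sigma>\<in>C. state_ev M t \<sigma> = Yes"
    and A5: "\<lbrakk>\<sigma> \<in> states M; \<sigma>' \<in> states M; \<sigma> \<sqsubset> \<sigma>'\<rbrakk> \<Longrightarrow>
      \<exists>\<sigma>''\<in>states M. \<sigma> \<lessdot> \<sigma>'' \<and> \<sigma>'' \<sqsubseteq> \<sigma>'"
    and A6a: "\<lbrakk>\<sigma>\<^sub>1 \<in> states M; \<sigma>\<^sub>2 \<in> states M; \<sigma>\<^sub>2' \<in> states M; \<sigma>\<^sub>1 \<sqsubseteq> \<sigma>\<^sub>2; \<sigma>\<^sub>2 \<sqsubseteq> \<sigma>\<^sub>2'\<rbrakk> \<Longrightarrow>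
      \<exists>\<sigma>\<^sub>1'\<in>states M. is_glb L \<sigma>\<^sub>1 {\<sigma>\<^sub>1', \<sigma>\<^sub>2} \<and> is_lub L \<sigma>\<^sub>2' {\<sigma>\<^sub>1', \<sigma>\<^sub>2}"
    and A6b: "\<lbrakk>\<sigma>\<^sub>1' \<in> states M; \<sigma>\<^sub>2 \<in> states M; \<sigma>\<^sub>2' \<in> states M;
        \<sigma>\<^sub>1' \<sqsubseteq> \<sigma>\<^sub>2'; \<sigma>\<^sub>2 \<lessdot> \<sigma>\<^sub>2'; \<not> \<sigma>\<^sub>1' \<sqsubseteq> \<sigma>\<^sub>2\<rbrakk> \<Longrightarrow> (\<sigma>\<^sub>1' \<sqinter> \<sigma>\<^sub>2) \<lessdot> \<sigma>\<^sub>1'"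
    and A6c: "\<lbrakk>\<sigma>\<^sub>1 \<in> states M; \<sigma>\<^sub>1' \<in> states M; \<sigma>\<^sub>2 \<in> states M; \<sigma>\<^sub>2' \<in> states M;
        \<sigma>\<^sub>1 \<sqsubseteq> \<sigma>\<^sub>1'; \<sigma>\<^sub>1' \<sqsubseteq> \<sigma>\<^sub>2'; \<sigma>\<^sub>1 \<lessdot> \<sigma>\<^sub>2; \<sigma>\<^sub>2 \<sqsubseteq> \<sigma>\<^sub>2'; \<not> \<sigma>\<^sub>2 \<sqsubseteq> \<sigma>\<^sub>1'\<rbrakk> \<Longrightarrow>
      \<sigma>\<^sub>1' \<lessdot> (\<sigma>\<^sub>1' \<squnion> \<sigma>\<^sub>2)"


section \<open>Generalized tests and schemes\<close>

definition generalized_test :: "('a, 'b) gorder_scheme \<Rightarrow> 'a \<times> 'a \<Rightarrow> bool"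
  where "generalized_test L u \<longleftrightarrow>
    fst u \<in> carrier L \<and> snd u \<in> carrier L \<and> \<not> consistent L (fst u) (snd u)"

definition gen_ev :: "('a, 'b) gorder_scheme \<Rightarrow> 'a \<times> 'a \<Rightarrow> 'a \<Rightarrow> verdict"
  where "gen_ev L u \<sigma> =
    (if fst u \<sqsubseteq>\<^bsub>L\<^esub> \<sigma> then Yes else if snd u \<sqsubseteq>\<^bsub>L\<^esub> \<sigma> then No else Undet)"

definition discriminating :: "('a, 'b) gorder_scheme \<Rightarrow> 'a \<times> 'a \<Rightarrow> bool"
  where "discriminating L u \<longleftrightarrow> generalized_test L u \<and>
    (\<forall>x\<in>carrier L. x \<sqsubset>\<^bsub>L\<^esub> snd u \<longrightarrow> consistent L (fst u) x) \<and>
    (\<forall>x\<in>carrier L. x \<sqsubset>\<^bsub>L\<^esub> fst u \<longrightarrow> consistent L (snd u) x)"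

locale scheme =
  fixes L :: "('a, 'b) gorder_scheme" (structure) and U :: "('a \<times> 'a) set"
  assumes generalized: "u \<in> U \<Longrightarrow> generalized_test L u"
    and complete: "\<lbrakk>\<Sigma> \<in> carrier L; \<Sigma> \<noteq> \<bottom>\<rbrakk> \<Longrightarrow> \<exists>\<Sigma>'. (\<Sigma>, \<Sigma>') \<in> U"
    and irredundant: "\<lbrakk>(\<Sigma>\<^sub>1, \<Sigma>\<^sub>1') \<in> U; (\<Sigma>\<^sub>2, \<Sigma>\<^sub>2') \<in> U\<rbrakk> \<Longrightarrow> \<Sigma>\<^sub>1 \<sqsubseteq> \<Sigma>\<^sub>2 \<longleftrightarrow> \<Sigma>\<^sub>2' \<sqsubseteq> \<Sigma>\<^sub>1'"
    and closed_conjugate: "(\<Sigma>, \<Sigma>') \<in> U \<Longrightarrow> (\<Sigma>', \<Sigma>) \<in> U"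
    and closed_join: "\<lbrakk>(\<Sigma>\<^sub>1, \<Sigma>\<^sub>1') \<in> U; (\<Sigma>\<^sub>2, \<Sigma>\<^sub>2') \<in> U; consistent L \<Sigma>\<^sub>1 \<Sigma>\<^sub>2\<rbrakk> \<Longrightarrow>
      (\<Sigma>\<^sub>1 \<squnion> \<Sigma>\<^sub>2, \<Sigma>\<^sub>1' \<sqinter> \<Sigma>\<^sub>2') \<in> U"


section \<open>Orthogonality and ortho-closed sets of pure states\<close>

definition orthogonal :: "('a, 'b) gorder_scheme \<Rightarrow> ('a \<times> 'a) set \<Rightarrow> 'a \<Rightarrow> 'a \<Rightarrow> bool"
  where "orthogonal L U \<sigma>\<^sub>1 \<sigma>\<^sub>2 \<longleftrightarrow>
    \<sigma>\<^sub>1 \<in> carrier L \<and> \<sigma>\<^sub>1 \<noteq> \<bottom>\<^bsub>L\<^esub> \<and> \<sigma>\<^sub>2 \<in> carrier L \<and> \<sigma>\<^sub>2 \<noteq> \<bottom>\<^bsub>L\<^esub> \<and>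
    (\<exists>(\<Sigma>, \<Sigma>')\<in>U. \<Sigma> \<sqsubseteq>\<^bsub>L\<^esub> \<sigma>\<^sub>1 \<and> \<Sigma>' \<sqsubseteq>\<^bsub>L\<^esub> \<sigma>\<^sub>2)"

definition perp :: "('a, 'b) gorder_scheme \<Rightarrow> ('a \<times> 'a) set \<Rightarrow> 'a set \<Rightarrow> 'a set"
  where "perp L U S = {\<sigma>' \<in> pure L. \<forall>\<sigma>\<in>S. orthogonal L U \<sigma> \<sigma>'}"

record 'a ortho_order = "'a gorder" +
  ocomp :: "'a \<Rightarrow> 'a"

definition closed_pure_sets ::
    "('a, 'b) gorder_scheme \<Rightarrow> ('a \<times> 'a) set \<Rightarrow> 'a set ortho_order"
  where "closed_pure_sets L U =
    \<lparr> carrier = {c. c \<subseteq> pure L \<and> perp L U (perp L U c) = c}, eq = (=), le = (\<subseteq>),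
      ocomp = perp L U \<rparr>"

definition atoms :: "('a, 'b) gorder_scheme \<Rightarrow> 'a set"
  where "atoms L = {a. \<bottom>\<^bsub>L\<^esub> \<lessdot>\<^bsub>L\<^esub> a}"

definition ortho_morphism ::
    "('a, 'c) ortho_order_scheme \<Rightarrow> ('b, 'd) ortho_order_scheme \<Rightarrow> ('a \<Rightarrow> 'b) \<Rightarrow> bool"
  where "ortho_morphism K L \<phi> \<longleftrightarrow>
    \<phi> \<in> carrier K \<rightarrow> carrier L \<and>
    (\<forall>A \<subseteq> carrier K. \<phi> (\<Squnion>\<^bsub>K\<^esub>A) = \<Squnion>\<^bsub>L\<^esub>(\<phi> ` A)) \<and>
    \<phi> ` atoms K \<subseteq> atoms L \<and>
    (\<forall>c\<in>carrier K. \<phi> (ocomp K c) = ocomp L (\<phi> c))"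


section \<open>Symmetries\<close>

definition symmetry ::
    "('p, 't) test_system \<Rightarrow> ('q, 'u) test_system \<Rightarrow> ('p set \<Rightarrow> 'q set) \<Rightarrow> ('u \<Rightarrow> 't) \<Rightarrow> bool"
  where "symmetry M\<^sub>1 M\<^sub>2 f g \<longleftrightarrow>
    f \<in> states M\<^sub>1 \<rightarrow> states M\<^sub>2 \<and> g \<in> Test M\<^sub>2 \<rightarrow> Test M\<^sub>1 \<and>
    (\<forall>t\<in>Test M\<^sub>2. \<forall>\<sigma>\<in>states M\<^sub>1. state_ev M\<^sub>2 t (f \<sigma>) = state_ev M\<^sub>1 (g t) \<sigma>) \<and>
    (\<forall>t\<in>Test M\<^sub>2. \<forall>\<sigma>\<in>states M\<^sub>1. state_ev M\<^sub>2 t (f \<sigma>) \<le> Yes \<longrightarrow>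
      state_meas M\<^sub>2 (f \<sigma>) t = f (state_meas M\<^sub>1 \<sigma> (g t))) \<and>
    (\<forall>t\<in>Test M\<^sub>2. \<forall>t'\<in>Test M\<^sub>2. g (succession M\<^sub>2 t t') = succession M\<^sub>1 (g t) (g t')) \<and>
    inj_on f (states M\<^sub>1) \<and> g ` Test M\<^sub>2 = Test M\<^sub>1"

text \<open>
  The extension \<open>h\<close> of the test component of a symmetry to the generalized tests of a scheme.
  It is determined by the evaluation identity, since a generalized test is determined by its
  evaluation map.
\<close>

definition preserves_schemes ::
    "('a, 'c) gorder_scheme \<Rightarrow> ('a \<times> 'a) set \<Rightarrow> ('b, 'd) gorder_scheme \<Rightarrow> ('b \<times> 'b) set \<Rightarrow>
      ('a \<Rightarrow> 'b) \<Rightarrow> ('b \<times> 'b \<Rightarrow> 'a \<times> 'a) \<Rightarrow> bool"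
  where "preserves_schemes L\<^sub>1 U\<^sub>1 L\<^sub>2 U\<^sub>2 f h \<longleftrightarrow>
    (\<forall>u\<in>U\<^sub>2. \<forall>\<sigma>\<in>carrier L\<^sub>1. gen_ev L\<^sub>2 u (f \<sigma>) = gen_ev L\<^sub>1 (h u) \<sigma>) \<and> h ` U\<^sub>2 = U\<^sub>1"

definition induced_map ::
    "('b, 'd) gorder_scheme \<Rightarrow> ('b \<times> 'b) set \<Rightarrow> ('a \<Rightarrow> 'b) \<Rightarrow> 'a set \<Rightarrow> 'b set"
  where "induced_map L\<^sub>2 U\<^sub>2 f c = \<Squnion>\<^bsub>closed_pure_sets L\<^sub>2 U\<^sub>2\<^esub> ((\<lambda>\<sigma>. {f \<sigma>}) ` c)"


section \<open>Consistency of the definitions\<close>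

lemma Greatest_verdict_is_glb:
  assumes "P \<noteq> {}"
  shows "\<forall>q\<in>P. (GREATEST v :: verdict. \<forall>q\<in>P. v \<le> e q) \<le> e q"
    and "(\<forall>q\<in>P. w \<le> e q) \<Longrightarrow> w \<le> (GREATEST v :: verdict. \<forall>q\<in>P. v \<le> e q)"
proof -
  obtain m where m: "\<forall>q\<in>P. m \<le> e q" "\<And>v. \<forall>q\<in>P. v \<le> e q \<Longrightarrow> v \<le> m"
  proof (cases "\<exists>m. \<forall>q\<in>P. e q = m")
    case True
    then obtain m where "\<forall>q\<in>P. e q = m" by blast
    with that[of m] assms show ?thesis by auto
  next
    case False
    then have "v \<le> Undet" if "\<forall>q\<in>P. v \<le> e q" for v
      using that by (metis less_eq_verdict_def)
    with that[of Undet] show ?thesis by (simp add: less_eq_verdict_def)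
  qed
  then have "(GREATEST v. \<forall>q\<in>P. v \<le> e q) = m" by (intro Greatest_equality)
  then show "\<forall>q\<in>P. (GREATEST v. \<forall>q\<in>P. v \<le> e q) \<le> e q"
    and "(\<forall>q\<in>P. w \<le> e q) \<Longrightarrow> w \<le> (GREATEST v. \<forall>q\<in>P. v \<le> e q)"
    using m by blast+
qed

lemma equiv_state_eq: "equiv (Prep M) (state_eq M)"
  by (rule equivI) (auto simp: state_eq_def refl_on_def sym_def trans_def)

lemma state_of_eqD:
  assumes "q \<in> state_of M p" "t \<in> Test M"
  shows "ev M q t = ev M p t"
  using assms by (auto simp: state_of_def state_eq_def)

lemma self_in_state_of: "p \<in> Prep M \<Longrightarrow> p \<in> state_of M p"
  by (auto simp: state_of_def state_eq_def)

lemma state_ev_state_of: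
  assumes "p \<in> Prep M" "t \<in> Test M"
  shows "state_ev M t (state_of M p) = ev M p t"
proof -
  have "(\<lambda>q. ev M q t) ` state_of M p = {ev M p t}"
    using state_of_eqD[OF _ assms(2)] self_in_state_of[OF assms(1)]
    by (intro equalityI subsetI) (blast intro: sym)+
  then show ?thesis by (simp add: state_ev_def)
qed

lemma (in measurement_data) meas_state_eq:
  assumes t: "t \<in> Test M" and p: "p \<in> maybe_set M t" and q: "(p, q) \<in> state_eq M"
  shows "(meas M p t, meas M q t) \<in> state_eq M"
proof -
  have P: "p \<in> Prep M" "q \<in> Prep M" and E: "\<And>s. s \<in> Test M \<Longrightarrow> ev M p s = ev M q s"
    using q by (auto simp: state_eq_def)
  have q': "q \<in> maybe_set M t" using p P E[OF t] by (auto simp: maybe_set_def)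
  note C = meas_closed[OF t p] meas_closed[OF t q']
  have "ev M (meas M p t) s = ev M (meas M q t) s" if s: "s \<in> Test M" for s
  proof -
    let ?c = "succession M t s"
    have c: "?c \<in> Test M" by (simp add: t s succession_closed)
    have 1: "(ev M (meas M r t) s \<le> Yes) = (ev M r ?c \<le> Yes)"
      if "r \<in> maybe_set M t" "r \<in> Prep M" "meas M r t \<in> Prep M" for r
      using maybe_succession[OF t s] that by (auto simp: maybe_set_def set_eq_iff)
    let ?d = "succession M t (bar M s)"
    have bs: "bar M s \<in> Test M" by (rule bar_closed[OF s])
    have d: "?d \<in> Test M" by (simp add: t bs succession_closed)
    have 3: "(ev M (meas M r t) (bar M s) \<le> Yes) = (ev M r ?d \<le> Yes)"
      if "r \<in> maybe_set M t" "r \<in> Prep M" "meas M r t \<in> Prep M" for r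
      using maybe_succession[OF t bs] that by (auto simp: maybe_set_def set_eq_iff)
    have "(ev M (meas M p t) s \<le> Yes) = (ev M (meas M q t) s \<le> Yes)"
      using 1[OF p P(1) C(1)] 1[OF q' P(2) C(2)] E[OF c] by simp
    moreover have "(neg (ev M (meas M p t) s) \<le> Yes) = (neg (ev M (meas M q t) s) \<le> Yes)"
      using 3[OF p P(1) C(1)] 3[OF q' P(2) C(2)] E[OF d] ev_bar[OF C(1) s] ev_bar[OF C(2) s]
      by simp
    ultimately show ?thesis
      by (cases "ev M (meas M p t) s"; cases "ev M (meas M q t) s")
        (auto simp: less_eq_verdict_def)
  qed
  then show ?thesis using C by (auto simp: state_eq_def)
qed

lemma (in measurement_data) state_meas_state_of:
  assumes t: "t \<in> Test M" and p: "p \<in> maybe_set M t"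
  shows "state_meas M (state_of M p) t = state_of M (meas M p t)"
proof -
  have p': "p \<in> Prep M" using p by (simp add: maybe_set_def)
  have "state_of M (meas M q t) = state_of M (meas M p t)" if "q \<in> state_of M p" for q
    using equiv_class_eq[OF equiv_state_eq meas_state_eq[OF t p, of q]] that
    by (simp add: state_of_def)
  then have "(\<lambda>q. state_of M (meas M q t)) ` state_of M p = {state_of M (meas M p t)}"
    using self_in_state_of[OF p'] by (intro equalityI subsetI) (blast intro: sym)+
  then show ?thesis by (simp add: state_meas_def)
qed

lemma partial_order_state_poset: "partial_order (state_poset M)"
proof -
  have "\<sigma> = \<tau>"
    if "\<sigma> \<in> states M" "\<tau> \<in> states M"
      and *: "\<forall>t\<in>Test M. state_ev M t \<sigma> \<le> state_ev M t \<tau>"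
             "\<forall>t\<in>Test M. state_ev M t \<tau> \<le> state_ev M t \<sigma>" for \<sigma> \<tau>
  proof -
    from that(1,2) obtain p q where pq: "p \<in> Prep M" "q \<in> Prep M"
      "\<sigma> = state_of M p" "\<tau> = state_of M q"
      by (auto simp: states_def state_of_def quotient_def)
    have "ev M p t = ev M q t" if "t \<in> Test M" for t
      using * that pq by (auto simp: state_ev_state_of intro: order_antisym)
    then have "(p, q) \<in> state_eq M" using pq by (simp add: state_eq_def)
    then show ?thesis
      using equiv_class_eq[OF equiv_state_eq] pq by (simp add: state_of_def)
  qed
  moreover have "\<forall>t\<in>Test M. state_ev M t \<sigma> \<le> state_ev M t \<upsilon>"
    if "\<forall>t\<in>Test M. state_ev M t \<sigma> \<le> state_ev M t \<tau>"
       "\<forall>t\<in>Test M. state_ev M t \<tau> \<le> state_ev M t \<upsilon>" for \<sigma> \<tau> \<upsilon>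
    using that by (meson order_trans)
  ultimately show ?thesis
    by unfold_locales (simp_all add: state_poset_def)
qed

lemma partial_order_closed_pure_sets: "partial_order (closed_pure_sets L U)"
  by unfold_locales (simp_all add: closed_pure_sets_def)

lemma (in scheme) orthogonal_sym: "orthogonal L U \<sigma> \<tau> \<Longrightarrow> orthogonal L U \<tau> \<sigma>"
  unfolding orthogonal_def by (blast intro: closed_conjugate)

lemma (in scheme) sup_closed_pure_sets:
  assumes "A \<subseteq> carrier (closed_pure_sets L U)"
  shows "is_lub (closed_pure_sets L U) (perp L U (perp L U (\<Union>A))) A"
    and "\<Squnion>\<^bsub>closed_pure_sets L U\<^esub>A = perp L U (perp L U (\<Union>A))"
proof -
  let ?p = "perp L U" and ?C = "closed_pure_sets L U"
  have anti: "?p T \<subseteq> ?p S" if "S \<subseteq> T" for S T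
    using that by (auto simp: perp_def)
  have ext: "S \<subseteq> ?p (?p S)" if "S \<subseteq> pure L" for S
    using that unfolding perp_def by (blast intro: orthogonal_sym)
  have sub: "?p S \<subseteq> pure L" for S by (auto simp: perp_def)
  have tri: "?p (?p (?p S)) = ?p S" if "S \<subseteq> pure L" for S
    using anti[OF ext[OF that]] ext[OF sub] by blast
  have UA: "\<Union>A \<subseteq> pure L" using assms by (auto simp: closed_pure_sets_def)
  show lub: "is_lub ?C (?p (?p (\<Union>A))) A"
    unfolding least_def
  proof (intro conjI ballI)
    show "Upper ?C A \<subseteq> carrier ?C" by (auto simp: Upper_def)
    show "?p (?p (\<Union>A)) \<in> Upper ?C A"
      using ext[OF UA] sub tri[OF sub] by (auto simp: Upper_def closed_pure_sets_def)
    fix x assume x: "x \<in> Upper ?C A"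
    then have xc: "?p (?p x) = x"
      by (simp add: Upper_def closed_pure_sets_def)
    have "a \<subseteq> x" if "a \<in> A" for a
      using x that assms by (force simp: Upper_def closed_pure_sets_def)
    then have "\<Union>A \<subseteq> x" by blast
    from anti[OF anti[OF this]] xc show "?p (?p (\<Union>A)) \<sqsubseteq>\<^bsub>?C\<^esub> x"
      by (simp add: closed_pure_sets_def)
  qed
  show "\<Squnion>\<^bsub>?C\<^esub>A = ?p (?p (\<Union>A))"
    unfolding sup_def
  proof (rule some_equality[where P = "\<lambda>x. is_lub ?C x A"])
    show "is_lub ?C (?p (?p (\<Union>A))) A" by (rule lub)
    show "x = ?p (?p (\<Union>A))" if "is_lub ?C x A" for x
      by (rule partial_order.least_unique[OF partial_order_closed_pure_sets that lub])
  qed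
qed

end

theory Submission
  imports Defs
begin

text \<open>
  If a test is not answered yes on \<open>\<sigma>\<close>, then by A3, A4 and Zorn's lemma there is a maximal one among
  the states above \<open>\<sigma>\<close> with this property, and by A1 it is pure; hence pure states separate states.
  A scheme is the graph of an order-reversing involution of the non-bottom states, so the
  separation makes every singleton of a pure state ortho-closed. Surjectivity of \<open>g\<close> makes \<open>f\<close> an
  order embedding, and evaluating the generalized tests of the second scheme on states \<open>f \<sigma>\<close>
  gives it a totally defined left adjoint \<open>\<Sigma> \<mapsto> fst (h (\<Sigma>, \<Sigma>'))\<close>. In particular each state lies below
  some \<open>f \<sigma>\<close>, and \<open>f\<close> restricts to a bijection of maximal states that preserves
  and reflects orthogonality. So the induced map is just \<open>c \<mapsto> f ` c\<close>.
\<close>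

section \<open>States, verdicts and maximal states\<close>

lemma carrier_state_poset [simp]: "carrier (state_poset M) = states M"
  by (simp add: state_poset_def)

lemma le_state_poset:
  "\<sigma> \<sqsubseteq>\<^bsub>state_poset M\<^esub> \<tau> \<longleftrightarrow> (\<forall>t\<in>Test M. state_ev M t \<sigma> \<le> state_ev M t \<tau>)"
  by (simp add: state_poset_def)

lemma statesE:
  assumes "\<sigma> \<in> states M"
  obtains p where "p \<in> Prep M" "\<sigma> = state_of M p"
  using assms by (auto simp: states_def state_of_def quotient_def)

lemma state_of_in_states: "p \<in> Prep M \<Longrightarrow> state_of M p \<in> states M"
  by (auto simp: states_def state_of_def quotient_def)

lemma (in measurement_data) state_ev_bar:
  assumes "\<sigma> \<in> states M" "t \<in> Test M"
  shows "state_ev M (bar M t) \<sigma> = neg (state_ev M t \<sigma>)"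
  using assms by (auto elim!: statesE simp: state_ev_state_of bar_closed ev_bar)

text \<open>A nonempty set with infimum \<open>x\<close> has a member above \<open>x\<close>, and
  maximality leaves only \<open>x\<close> itself.\<close>

lemma maximal_imp_pure: "maximal_elements L \<subseteq> pure L"
proof
  fix x assume x: "x \<in> maximal_elements L"
  have "x \<in> A" if A: "A \<subseteq> carrier L" "A \<noteq> {}" "is_glb L x A" for A
  proof -
    obtain a where a: "a \<in> A" using A by blast
    then have "x \<sqsubseteq>\<^bsub>L\<^esub> a" using A by (auto simp: greatest_def Lower_def)
    moreover have "a \<in> carrier L" using A(1) a by blast
    ultimately show ?thesis using x a by (auto simp: maximal_elements_def)
  qed
  then show "x \<in> pure L" using x by (auto simp: pure_def maximal_elements_def)
qed


section \<open>Pure states separate states\<close>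

context state_system
begin

lemma least_state: "\<exists>x. least L x (carrier L)"
proof -
  obtain p where p: "p \<in> Prep M" "\<forall>t\<in>Test M. ev M p t = Undet"
    using A2 by blast
  then have "least L (state_of M p) (carrier L)"
    by (auto simp: least_def L_def le_state_poset state_ev_state_of state_of_in_states
        less_eq_verdict_def)
  then show ?thesis ..
qed

text \<open>A1 yields a preparation whose verdict on every test is the meet over \<open>S\<close>.
  Its state is a lower bound of \<open>S\<close>, hence lies below \<open>m\<close>, and a verdict
  above \<open>Yes\<close> is \<open>Yes\<close>.\<close>

lemma state_ev_glb_eq_Yes:
  assumes S: "S \<subseteq> states M" "S \<noteq> {}" and m: "is_glb L m S" and t: "t \<in> Test M"
    and Yes: "\<And>\<sigma>. \<sigma> \<in> S \<Longrightarrow> state_ev M t \<sigma> = Yes"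
  shows "state_ev M t m = Yes"
proof -
  \<comment> \<open>A1 speaks of preparations, so \<open>S\<close> is replaced by all
    representatives of its states.\<close>
  define P where "P = {p \<in> Prep M. state_of M p \<in> S}"
  have P: "P \<subseteq> Prep M" "P \<noteq> {}"
    using S by (auto simp: P_def elim!: statesE)
  obtain p where p: "p \<in> Prep M"
    and ev: "\<forall>t\<in>Test M. ev M p t = (GREATEST v. \<forall>q\<in>P. v \<le> ev M q t)"
    using A1[OF P] by blast
  have le: "ev M p s \<le> ev M q s" if "s \<in> Test M" "q \<in> P" for s q
    using Greatest_verdict_is_glb(1)[OF P(2), of "\<lambda>q. ev M q s"] ev that by simp
  have "state_of M p \<in> Lower L S"
    unfolding Lower_def
  proof (clarsimp simp: L_def p state_of_in_states)
    fix \<sigma> assume \<sigma>: "\<sigma> \<in> S" "\<sigma> \<in> states M"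
    then obtain q where "q \<in> P" "\<sigma> = state_of M q"
      by (auto simp: P_def elim!: statesE)
    then show "state_of M p \<sqsubseteq>\<^bsub>state_poset M\<^esub> \<sigma>"
      using le p by (auto simp: le_state_poset state_ev_state_of P_def)
  qed
  then have "state_of M p \<sqsubseteq> m"
    using m by (simp add: greatest_def)
  then have "state_ev M t (state_of M p) \<le> state_ev M t m"
    using t by (simp add: L_def le_state_poset)
  moreover have "\<forall>q\<in>P. Yes \<le> ev M q t"
    using Yes t by (force simp: P_def state_ev_state_of)
  then have "Yes \<le> ev M p t"
    using Greatest_verdict_is_glb(2)[OF P(2), of Yes "\<lambda>q. ev M q t"] ev t by simp
  ultimately show ?thesis
    using p t by (simp add: state_ev_state_of less_eq_verdict_def)
qed

text \<open>The supremum from A3 is the bound; A4, read contrapositively, keeps its verdict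
  different from \<open>Yes\<close>.\<close>

lemma chain_not_Yes_upper_bound:
  assumes C: "C \<subseteq> states M" "C \<noteq> {}" "Complete_Partial_Order.chain (\<sqsubseteq>) C"
    and t: "t \<in> Test M" and not_Yes: "\<And>\<sigma>. \<sigma> \<in> C \<Longrightarrow> state_ev M t \<sigma> \<noteq> Yes"
  obtains u where "u \<in> states M" "state_ev M t u \<noteq> Yes" "\<And>\<sigma>. \<sigma> \<in> C \<Longrightarrow> \<sigma> \<sqsubseteq> u"
proof -
  have lub: "is_lub L (\<Squnion>C) C"
    unfolding sup_def by (rule someI_ex) (rule A3[OF C])
  show thesis
  proof
    show "\<Squnion>C \<in> states M"
      using lub by (simp add: least_def Upper_def L_def)
    show "state_ev M t (\<Squnion>C) \<noteq> Yes"
      using A4[OF C t] not_Yes by blast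
    show "\<sigma> \<sqsubseteq> \<Squnion>C" if "\<sigma> \<in> C" for \<sigma>
      using lub C(1) that by (auto simp: least_def Upper_def L_def)
  qed
qed

text \<open>Fix a test answered \<open>Yes\<close> on \<tau> but not on \<sigma>, and let
  \<open>m\<close> be maximal among the states above \<sigma> without a \<open>Yes\<close>. All
  states strictly above \<open>m\<close> answer \<open>Yes\<close>, and so would an infimum of them;
  hence \<open>m\<close> is pure.\<close>

lemma pure_separates:
  assumes \<sigma>: "\<sigma> \<in> states M" and \<tau>: "\<tau> \<in> states M" and "\<not> \<tau> \<sqsubseteq> \<sigma>"
  obtains m where "m \<in> pure L" "\<sigma> \<sqsubseteq> m" "\<not> \<tau> \<sqsubseteq> m"
proof -
  interpret partial_order L
    unfolding L_def by (rule partial_order_state_poset)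
  have car: "carrier L = states M" by (simp add: L_def)
  obtain s where s: "s \<in> Test M" "\<not> state_ev M s \<tau> \<le> state_ev M s \<sigma>"
    using assms(3) by (auto simp: L_def le_state_poset)
  \<comment> \<open>If the distinguishing verdict on \<tau> is \<open>No\<close>, the conjugate test
    turns it into \<open>Yes\<close>.\<close>
  obtain t where t: "t \<in> Test M" and \<tau>_Yes: "state_ev M t \<tau> = Yes"
    and \<sigma>_not: "state_ev M t \<sigma> \<noteq> Yes"
  proof (cases "state_ev M s \<tau>")
    case Undet
    with s show ?thesis by (simp add: less_eq_verdict_def)
  next
    case Yes
    with s that[of s] show ?thesis by (auto simp: less_eq_verdict_def)
  next
    case No
    with s that[of "bar M s"] \<sigma> \<tau> show ?thesis
      by (cases "state_ev M s \<sigma>") (auto simp: less_eq_verdict_def state_ev_bar bar_closed)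
  qed
  define A where "A = {x \<in> states M. \<sigma> \<sqsubseteq> x \<and> state_ev M t x \<noteq> Yes}"
  have \<sigma>A: "\<sigma> \<in> A" using \<sigma> \<sigma>_not by (auto simp: A_def car)
  have "\<exists>m\<in>A. \<forall>a\<in>A. m \<sqsubseteq> a \<longrightarrow> a = m"
  proof (rule predicate_Zorn)
    show "partial_order_on A (relation_of (\<sqsubseteq>) A)"
      by (rule partial_order_on_relation_ofI)
        (simp_all add: A_def car, metis car le_trans, metis car le_antisym)
    fix C assume "C \<in> Chains (relation_of (\<sqsubseteq>) A)"
    then have C: "C \<subseteq> A" "\<forall>x\<in>C. \<forall>y\<in>C. x \<sqsubseteq> y \<or> y \<sqsubseteq> x"
      by (auto simp: Chains_def relation_of_def)
    show "\<exists>u\<in>A. \<forall>a\<in>C. a \<sqsubseteq> u"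
    \<comment> \<open>A3 concerns nonempty chains; the empty one is bounded by \<sigma>. Otherwise a
      member of the chain puts the bound above \<sigma>.\<close>
    proof (cases "C = {}")
      case True
      with \<sigma>A show ?thesis by auto
    next
      case False
      then obtain c where c: "c \<in> C" by blast
      have "C \<subseteq> states M" "Complete_Partial_Order.chain (\<sqsubseteq>) C"
        "\<And>x. x \<in> C \<Longrightarrow> state_ev M t x \<noteq> Yes"
        using C by (auto simp: A_def Complete_Partial_Order.chain_def)
      then obtain u where u: "u \<in> states M" "state_ev M t u \<noteq> Yes" "\<And>x. x \<in> C \<Longrightarrow> x \<sqsubseteq> u"
        using chain_not_Yes_upper_bound[OF _ False _ t] by blast
      moreover have "\<sigma> \<sqsubseteq> u"
        using c C(1) u \<sigma> le_trans[of \<sigma> c u] by (simp add: A_def car subset_iff)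
      ultimately show ?thesis by (auto simp: A_def)
    qed
  qed
  then obtain m where m: "m \<in> A" and max: "\<And>a. \<lbrakk>a \<in> A; m \<sqsubseteq> a\<rbrakk> \<Longrightarrow> a = m"
    by blast
  have "m \<in> S" if S: "S \<subseteq> carrier L" "S \<noteq> {}" "is_glb L m S" for S
  proof (rule ccontr)
    assume "m \<notin> S"
    have "state_ev M t x = Yes" if x: "x \<in> S" for x
    proof (rule ccontr)
      assume "state_ev M t x \<noteq> Yes"
      moreover have "m \<sqsubseteq> x" using S x by (auto simp: greatest_def Lower_def)
      moreover have "\<sigma> \<sqsubseteq> x"
        using m S(1) x \<open>m \<sqsubseteq> x\<close> \<sigma> le_trans[of \<sigma> m x] by (simp add: A_def car subset_iff)
      ultimately have "x = m" using max[of x] S x by (auto simp: A_def car)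
      with x \<open>m \<notin> S\<close> show False by simp
    qed
    then have "state_ev M t m = Yes"
      using state_ev_glb_eq_Yes[OF _ S(2,3) t] S(1) car by blast
    with m show False by (simp add: A_def)
  qed
  then have "m \<in> pure L"
    using m by (auto simp: pure_def A_def car)
  moreover have "\<not> \<tau> \<sqsubseteq> m"
  proof
    assume "\<tau> \<sqsubseteq> m"
    then have "state_ev M t \<tau> \<le> state_ev M t m"
      using t by (simp add: L_def le_state_poset)
    with \<tau>_Yes m show False by (simp add: A_def less_eq_verdict_def)
  qed
  ultimately show thesis using that m by (auto simp: A_def)
qed

end


section \<open>Ortho-closed sets of pure states\<close>

text \<open>In this abstraction a state system keeps only its order, with a bottom and the
  separation of states by pure ones.\<close>

locale separated_scheme =
  partial_order L + weak_partial_order_bottom L + scheme L U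
  for L :: "('a, 'b) gorder_scheme" (structure) and U :: "('a \<times> 'a) set" +
  assumes separated: "\<lbrakk>\<sigma> \<in> carrier L; \<tau> \<in> carrier L; \<not> \<tau> \<sqsubseteq> \<sigma>\<rbrakk> \<Longrightarrow>
      \<exists>m\<in>pure L. \<sigma> \<sqsubseteq> m \<and> \<not> \<tau> \<sqsubseteq> m"
    and pure_subset_maximal: "pure L \<subseteq> maximal_elements L"
begin

lemma pure_eq_maximal: "pure L = maximal_elements L"
  using pure_subset_maximal maximal_imp_pure by (rule equalityI)

lemma pure_closed: "\<sigma> \<in> pure L \<Longrightarrow> \<sigma> \<in> carrier L"
  by (simp add: pure_def)

lemma pure_le_eq: "\<lbrakk>\<sigma> \<in> pure L; \<tau> \<in> carrier L; \<sigma> \<sqsubseteq> \<tau>\<rbrakk> \<Longrightarrow> \<tau> = \<sigma>"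
  by (simp add: pure_eq_maximal maximal_elements_def)

lemma test_closed:
  assumes "(\<Sigma>, \<Sigma>') \<in> U"
  shows "\<Sigma> \<in> carrier L" "\<Sigma>' \<in> carrier L"
  using generalized[OF assms] by (auto simp: generalized_test_def)

lemma test_not_below_both:
  assumes "(\<Sigma>, \<Sigma>') \<in> U" "\<Sigma> \<sqsubseteq> \<sigma>" "\<Sigma>' \<sqsubseteq> \<sigma>" "\<sigma> \<in> carrier L"
  shows False
  using generalized[OF assms(1)] assms(2-) by (auto simp: generalized_test_def consistent_def)

text \<open>If one state were bottom, both components of the test would lie below the other,
  contradicting their inconsistency.\<close>

lemma orthogonal_iff:
  "orthogonal L U \<sigma> \<tau> \<longleftrightarrow> \<sigma> \<in> carrier L \<and> \<tau> \<in> carrier L \<and> (\<exists>(\<Sigma>, \<Sigma>')\<in>U. \<Sigma> \<sqsubseteq> \<sigma> \<and> \<Sigma>' \<sqsubseteq> \<tau>)"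
proof -
  have "\<sigma> \<noteq> \<bottom> \<and> \<tau> \<noteq> \<bottom>"
    if "\<sigma> \<in> carrier L" "\<tau> \<in> carrier L" and u: "(\<Sigma>, \<Sigma>') \<in> U" "\<Sigma> \<sqsubseteq> \<sigma>" "\<Sigma>' \<sqsubseteq> \<tau>" for \<Sigma> \<Sigma>'
  proof -
    note cl = test_closed[OF u(1)]
    have "\<Sigma> \<sqsubseteq> \<tau>" if "\<sigma> = \<bottom>"
      using that u cl \<open>\<tau> \<in> carrier L\<close> le_trans[of \<Sigma> \<bottom> \<tau>] by simp
    moreover have "\<Sigma>' \<sqsubseteq> \<sigma>" if "\<tau> = \<bottom>"
      using that u cl \<open>\<sigma> \<in> carrier L\<close> le_trans[of \<Sigma>' \<bottom> \<sigma>] by simp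
    ultimately show ?thesis
      using test_not_below_both[OF u(1)] u that by blast
  qed
  then show ?thesis by (auto simp: orthogonal_def)
qed

lemma not_orthogonal_self: "\<not> orthogonal L U \<sigma> \<sigma>"
  using test_not_below_both by (auto simp: orthogonal_iff)

lemma perp_subset: "perp L U S \<subseteq> pure L"
  by (auto simp: perp_def)

lemma subset_perp_perp: "S \<subseteq> pure L \<Longrightarrow> S \<subseteq> perp L U (perp L U S)"
  unfolding perp_def by (blast intro: orthogonal_sym)

text \<open>Being orthogonal to a state amounts to lying above its partner in the scheme. For \<tau>
  \<noteq> \<sigma>, irredundancy keeps the partner of \<tau> from lying below that of \<sigma>, so
  separation gives a pure \<rho> orthogonal to \<sigma> but not to \<tau>.\<close>

lemma perp_perp_singleton:
  assumes \<sigma>: "\<sigma> \<in> pure L"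
  shows "perp L U (perp L U {\<sigma>}) = {\<sigma>}"
proof (rule antisym)
  show "{\<sigma>} \<subseteq> perp L U (perp L U {\<sigma>})"
    using \<sigma> by (intro subset_perp_perp) simp
  show "perp L U (perp L U {\<sigma>}) \<subseteq> {\<sigma>}"
  proof (rule ccontr)
    assume "\<not> ?thesis"
    then obtain \<tau> where \<tau>: "\<tau> \<in> perp L U (perp L U {\<sigma>})" and ne: "\<tau> \<noteq> \<sigma>" by blast
    then have \<tau>p: "\<tau> \<in> pure L" using perp_subset by blast
    note c = pure_closed[OF \<sigma>] pure_closed[OF \<tau>p]
    \<comment> \<open>Distinct maximal states are incomparable; hence neither is bottom and
      completeness supplies both partners.\<close>
    have nle: "\<not> \<sigma> \<sqsubseteq> \<tau>" "\<not> \<tau> \<sqsubseteq> \<sigma>"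
      using pure_le_eq[OF \<sigma> c(2)] pure_le_eq[OF \<tau>p c(1)] ne by auto
    then have "\<sigma> \<noteq> \<bottom>" "\<tau> \<noteq> \<bottom>" using c by auto
    then obtain \<sigma>' \<tau>' where u: "(\<sigma>, \<sigma>') \<in> U" "(\<tau>, \<tau>') \<in> U"
      using complete c by blast
    note cl = test_closed(2)[OF u(1)] test_closed(2)[OF u(2)]
    have "\<not> \<tau>' \<sqsubseteq> \<sigma>'" using irredundant[OF u] nle by simp
    then obtain \<rho> where \<rho>: "\<rho> \<in> pure L" "\<sigma>' \<sqsubseteq> \<rho>" "\<not> \<tau>' \<sqsubseteq> \<rho>"
      using separated cl by blast
    have "orthogonal L U \<sigma> \<rho>"
      using u(1) c \<rho> pure_closed by (auto simp: orthogonal_iff)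
    with \<rho> have "orthogonal L U \<rho> \<tau>" using \<tau> by (simp add: perp_def)
    then obtain \<Sigma> \<Sigma>' where v: "(\<Sigma>, \<Sigma>') \<in> U" "\<Sigma> \<sqsubseteq> \<rho>" "\<Sigma>' \<sqsubseteq> \<tau>"
      by (auto simp: orthogonal_iff)
    \<comment> \<open>Irredundancy, applied to the conjugate of the test found, reverses
      \<open>\<Sigma>' \<sqsubseteq> \<tau>\<close>.\<close>
    then have "\<tau>' \<sqsubseteq> \<Sigma>"
      using irredundant[OF closed_conjugate[OF v(1)] u(2)] by simp
    then have "\<tau>' \<sqsubseteq> \<rho>"
      using le_trans[OF _ v(2)] cl test_closed(1)[OF v(1)] pure_closed[OF \<rho>(1)] by simp
    with \<rho> show False by simp
  qed
qed

lemma mem_carrier_closed_pure_sets: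
  "c \<in> carrier (closed_pure_sets L U) \<longleftrightarrow> c \<subseteq> pure L \<and> perp L U (perp L U c) = c"
  by (simp add: closed_pure_sets_def)

text \<open>No pure state is orthogonal to itself, so none is orthogonal to all pure states and the
  empty set is closed.\<close>

lemma bottom_closed_pure_sets: "\<bottom>\<^bsub>closed_pure_sets L U\<^esub> = {}"
proof -
  let ?C = "closed_pure_sets L U"
  have "perp L U {} = pure L" by (auto simp: perp_def)
  moreover have "perp L U (pure L) = {}"
    using not_orthogonal_self by (auto simp: perp_def)
  ultimately have least: "least ?C {} (carrier ?C)"
    by (auto simp: least_def closed_pure_sets_def)
  show ?thesis
    unfolding bottom_def
    by (rule some_equality[where P = "\<lambda>x. least ?C x (carrier ?C)", OF least])
      (rule partial_order.least_unique[OF partial_order_closed_pure_sets _ least])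
qed

text \<open>Singletons of pure states are closed, so a minimal nonempty closed set is the singleton
  of any of its points.\<close>

lemma atoms_closed_pure_sets: "atoms (closed_pure_sets L U) = (\<lambda>\<sigma>. {\<sigma>}) ` pure L"
proof -
  let ?C = "closed_pure_sets L U"
  have cov: "a \<in> atoms ?C \<longleftrightarrow> {} \<in> carrier ?C \<and> a \<in> carrier ?C \<and> a \<noteq> {} \<and>
      \<not> (\<exists>z\<in>carrier ?C. z \<noteq> {} \<and> z \<subset> a)" for a
    unfolding atoms_def covers_def lless_def bottom_closed_pure_sets
    by (auto simp: closed_pure_sets_def)
  have sing: "{\<sigma>} \<in> carrier ?C" if "\<sigma> \<in> pure L" for \<sigma>
    using that by (simp add: mem_carrier_closed_pure_sets perp_perp_singleton)
  have "{} \<in> carrier ?C"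
    using not_orthogonal_self by (auto simp: mem_carrier_closed_pure_sets perp_def)
  then have "{\<sigma>} \<in> atoms ?C" if "\<sigma> \<in> pure L" for \<sigma>
    unfolding cov using sing[OF that] by auto
  moreover have "a \<in> (\<lambda>\<sigma>. {\<sigma>}) ` pure L" if a: "a \<in> atoms ?C" for a
  proof -
    obtain \<sigma> where \<sigma>: "\<sigma> \<in> a" using a cov by blast
    then have "\<sigma> \<in> pure L" using a cov mem_carrier_closed_pure_sets by blast
    moreover have "a = {\<sigma>}"
      using a \<sigma> sing[OF \<open>\<sigma> \<in> pure L\<close>] unfolding cov by blast
    ultimately show ?thesis by simp
  qed
  ultimately show ?thesis by blast
qed

end

lemma state_system_imp_separated_scheme:
  assumes "state_system M" "scheme (state_poset M) U"
    and "pure (state_poset M) \<subseteq> maximal_elements (state_poset M)"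
  shows "separated_scheme (state_poset M) U"
proof -
  interpret partial_order "state_poset M" by (rule partial_order_state_poset)
  interpret scheme "state_poset M" U by fact
  interpret weak_partial_order_bottom "state_poset M"
    by unfold_locales (rule state_system.least_state[OF assms(1)])
  show ?thesis
    by unfold_locales
      (use assms(3) in \<open>auto elim: state_system.pure_separates[OF assms(1)]\<close>)
qed


section \<open>Bijections of pure states that respect orthogonality\<close>

text \<open>Closed sets depend only on the pure states and their orthogonality, so this data carries
  one ortho-lattice onto the other.\<close>

locale pure_state_isomorphism =
  dom: separated_scheme L\<^sub>1 U\<^sub>1 + cod: separated_scheme L\<^sub>2 U\<^sub>2
  for L\<^sub>1 :: "('a, 'c) gorder_scheme" and U\<^sub>1
    and L\<^sub>2 :: "('b, 'd) gorder_scheme" and U\<^sub>2 and f :: "'a \<Rightarrow> 'b" +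
  assumes bij: "bij_betw f (pure L\<^sub>1) (pure L\<^sub>2)"
    and orthogonal_image: "\<lbrakk>\<sigma> \<in> pure L\<^sub>1; \<tau> \<in> pure L\<^sub>1\<rbrakk> \<Longrightarrow>
      orthogonal L\<^sub>2 U\<^sub>2 (f \<sigma>) (f \<tau>) \<longleftrightarrow> orthogonal L\<^sub>1 U\<^sub>1 \<sigma> \<tau>"
begin

abbreviation "C\<^sub>1 \<equiv> closed_pure_sets L\<^sub>1 U\<^sub>1"
abbreviation "C\<^sub>2 \<equiv> closed_pure_sets L\<^sub>2 U\<^sub>2"

lemma image_pure: "f ` pure L\<^sub>1 = pure L\<^sub>2"
  using bij by (simp add: bij_betw_def)

text \<open>Each pure state of the codomain is some \<open>f \<tau>\<close>, so membership on the
  left is a condition on \<tau>, and orthogonality transfers both ways.\<close>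

lemma perp_image:
  assumes "S \<subseteq> pure L\<^sub>1"
  shows "perp L\<^sub>2 U\<^sub>2 (f ` S) = f ` perp L\<^sub>1 U\<^sub>1 S"
  using assms orthogonal_image image_pure unfolding perp_def by (auto 0 3 simp: subset_iff)

lemma perp_perp_image:
  assumes "S \<subseteq> pure L\<^sub>1"
  shows "perp L\<^sub>2 U\<^sub>2 (perp L\<^sub>2 U\<^sub>2 (f ` S)) = f ` perp L\<^sub>1 U\<^sub>1 (perp L\<^sub>1 U\<^sub>1 S)"
  using perp_image[OF assms] perp_image[OF dom.perp_subset] by simp

lemma image_closed:
  assumes "c \<in> carrier C\<^sub>1"
  shows "f ` c \<in> carrier C\<^sub>2"
  using assms perp_perp_image[of c] image_pure
  by (auto simp: dom.mem_carrier_closed_pure_sets cod.mem_carrier_closed_pure_sets)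

text \<open>The join of the singletons is the double orthocomplement of the image of
  \<open>c\<close>; moving both complements inside the image leaves \<open>c\<close>, which is
  closed.\<close>

lemma induced_map_eq_image:
  assumes "c \<in> carrier C\<^sub>1"
  shows "induced_map L\<^sub>2 U\<^sub>2 f c = f ` c"
proof -
  have c: "c \<subseteq> pure L\<^sub>1" "perp L\<^sub>1 U\<^sub>1 (perp L\<^sub>1 U\<^sub>1 c) = c"
    using assms by (simp_all add: dom.mem_carrier_closed_pure_sets)
  then have "(\<lambda>\<sigma>. {f \<sigma>}) ` c \<subseteq> carrier C\<^sub>2"
    using image_pure cod.perp_perp_singleton
    by (simp add: cod.mem_carrier_closed_pure_sets image_subset_iff subset_iff) blast
  then have "induced_map L\<^sub>2 U\<^sub>2 f c = perp L\<^sub>2 U\<^sub>2 (perp L\<^sub>2 U\<^sub>2 (f ` c))"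
    unfolding induced_map_def by (simp add: cod.sup_closed_pure_sets(2) UNION_singleton_eq_range)
  then show ?thesis using perp_perp_image c by simp
qed

lemma inj_on_induced_map: "inj_on (induced_map L\<^sub>2 U\<^sub>2 f) (carrier C\<^sub>1)"
proof (rule inj_onI)
  fix c d assume "c \<in> carrier C\<^sub>1" "d \<in> carrier C\<^sub>1"
    and "induced_map L\<^sub>2 U\<^sub>2 f c = induced_map L\<^sub>2 U\<^sub>2 f d"
  then have "f ` c = f ` d" "c \<subseteq> pure L\<^sub>1" "d \<subseteq> pure L\<^sub>1"
    by (simp_all add: induced_map_eq_image) (simp_all add: dom.mem_carrier_closed_pure_sets)
  then show "c = d"
    using bij inj_on_image_eq_iff by (metis bij_betw_def)
qed

lemma ortho_morphism_induced_map: "ortho_morphism C\<^sub>1 C\<^sub>2 (induced_map L\<^sub>2 U\<^sub>2 f)"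
  unfolding ortho_morphism_def
proof (intro conjI allI impI ballI)
  show "induced_map L\<^sub>2 U\<^sub>2 f \<in> carrier C\<^sub>1 \<rightarrow> carrier C\<^sub>2"
    using image_closed by (simp add: induced_map_eq_image)
next
  fix A assume A: "A \<subseteq> carrier C\<^sub>1"
  then have UA: "\<Union>A \<subseteq> pure L\<^sub>1"
    using dom.mem_carrier_closed_pure_sets by blast
  have img: "induced_map L\<^sub>2 U\<^sub>2 f ` A = (`) f ` A"
    using A by (auto simp: induced_map_eq_image subset_iff)
  have "\<Squnion>\<^bsub>C\<^sub>1\<^esub>A \<in> carrier C\<^sub>1"
    using dom.sup_closed_pure_sets[OF A] by (simp add: least_def Upper_def)
  then have "induced_map L\<^sub>2 U\<^sub>2 f (\<Squnion>\<^bsub>C\<^sub>1\<^esub>A) = f ` perp L\<^sub>1 U\<^sub>1 (perp L\<^sub>1 U\<^sub>1 (\<Union>A))"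
    by (simp add: induced_map_eq_image dom.sup_closed_pure_sets(2)[OF A])
  \<comment> \<open>Images commute with unions and with double orthocomplements, and these compute
    the joins on both sides.\<close>
  also have "\<dots> = perp L\<^sub>2 U\<^sub>2 (perp L\<^sub>2 U\<^sub>2 (\<Union>((`) f ` A)))"
    using perp_perp_image[OF UA] by (simp add: image_Union)
  also have "\<dots> = \<Squnion>\<^bsub>C\<^sub>2\<^esub>(induced_map L\<^sub>2 U\<^sub>2 f ` A)"
    unfolding img using A image_closed by (intro cod.sup_closed_pure_sets(2)[symmetric]) blast
  finally show "induced_map L\<^sub>2 U\<^sub>2 f (\<Squnion>\<^bsub>C\<^sub>1\<^esub>A) = \<Squnion>\<^bsub>C\<^sub>2\<^esub>(induced_map L\<^sub>2 U\<^sub>2 f ` A)" .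
next
  have "induced_map L\<^sub>2 U\<^sub>2 f {\<sigma>} = {f \<sigma>}" if "\<sigma> \<in> pure L\<^sub>1" for \<sigma>
    using that
    by (simp add: induced_map_eq_image dom.mem_carrier_closed_pure_sets dom.perp_perp_singleton)
  then show "induced_map L\<^sub>2 U\<^sub>2 f ` atoms C\<^sub>1 \<subseteq> atoms C\<^sub>2"
    using image_pure
    by (simp add: dom.atoms_closed_pure_sets cod.atoms_closed_pure_sets image_subset_iff) blast
next
  fix c assume c: "c \<in> carrier C\<^sub>1"
  \<comment> \<open>The orthocomplement is itself closed, so the image formula applies to it as
    well.\<close>
  then have "perp L\<^sub>1 U\<^sub>1 c \<in> carrier C\<^sub>1"
    by (simp add: dom.mem_carrier_closed_pure_sets dom.perp_subset)
  moreover have "perp L\<^sub>2 U\<^sub>2 (f ` c) = f ` perp L\<^sub>1 U\<^sub>1 c"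
    using c by (intro perp_image) (simp add: dom.mem_carrier_closed_pure_sets)
  moreover have "ocomp C\<^sub>1 = perp L\<^sub>1 U\<^sub>1" "ocomp C\<^sub>2 = perp L\<^sub>2 U\<^sub>2"
    by (simp_all add: closed_pure_sets_def)
  ultimately show "induced_map L\<^sub>2 U\<^sub>2 f (ocomp C\<^sub>1 c) = ocomp C\<^sub>2 (induced_map L\<^sub>2 U\<^sub>2 f c)"
    using c by (simp add: induced_map_eq_image)
qed

end


section \<open>Symmetries are isomorphisms on pure states\<close>

lemma gen_ev_Yes_iff: "gen_ev L u \<sigma> = Yes \<longleftrightarrow> fst u \<sqsubseteq>\<^bsub>L\<^esub> \<sigma>"
  by (simp add: gen_ev_def)

text \<open>Since \<open>gen_ev\<close> tries \<open>Yes\<close> first, what matters is that no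
  state lies above both components: their inconsistency.\<close>

lemma gen_ev_No_iff:
  assumes "generalized_test L u" "\<sigma> \<in> carrier L"
  shows "gen_ev L u \<sigma> = No \<longleftrightarrow> snd u \<sqsubseteq>\<^bsub>L\<^esub> \<sigma>"
  using assms by (auto simp: gen_ev_def generalized_test_def consistent_def)

text \<open>Every test of \<open>M\<^sub>1\<close> is some \<open>g t\<close>, so comparing verdicts
  test by test is the same on both sides.\<close>

lemma symmetry_le_iff:
  assumes "symmetry M\<^sub>1 M\<^sub>2 f g" "\<sigma> \<in> states M\<^sub>1" "\<tau> \<in> states M\<^sub>1"
  shows "f \<sigma> \<sqsubseteq>\<^bsub>state_poset M\<^sub>2\<^esub> f \<tau> \<longleftrightarrow> \<sigma> \<sqsubseteq>\<^bsub>state_poset M\<^sub>1\<^esub> \<tau>"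
proof -
  have g: "Test M\<^sub>1 = g ` Test M\<^sub>2"
    and ev: "\<And>t \<rho>. \<lbrakk>t \<in> Test M\<^sub>2; \<rho> \<in> states M\<^sub>1\<rbrakk> \<Longrightarrow> state_ev M\<^sub>2 t (f \<rho>) = state_ev M\<^sub>1 (g t) \<rho>"
    using assms(1) by (auto simp: symmetry_def)
  show ?thesis
    unfolding le_state_poset g by (simp add: ev assms(2,3))
qed

lemma pure_state_isomorphism_of_embedding:
  fixes L\<^sub>1 :: "('a, 'c) gorder_scheme" and L\<^sub>2 :: "('b, 'd) gorder_scheme"
  assumes "separated_scheme L\<^sub>1 U\<^sub>1" "separated_scheme L\<^sub>2 U\<^sub>2"
    and f: "f \<in> carrier L\<^sub>1 \<rightarrow> carrier L\<^sub>2"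
    and emb: "\<And>\<sigma> \<tau>. \<lbrakk>\<sigma> \<in> carrier L\<^sub>1; \<tau> \<in> carrier L\<^sub>1\<rbrakk> \<Longrightarrow> f \<sigma> \<sqsubseteq>\<^bsub>L\<^sub>2\<^esub> f \<tau> \<longleftrightarrow> \<sigma> \<sqsubseteq>\<^bsub>L\<^sub>1\<^esub> \<tau>"
    and h: "preserves_schemes L\<^sub>1 U\<^sub>1 L\<^sub>2 U\<^sub>2 f h"
  shows "pure_state_isomorphism L\<^sub>1 U\<^sub>1 L\<^sub>2 U\<^sub>2 f"
proof -
  interpret dom: separated_scheme L\<^sub>1 U\<^sub>1 by fact
  interpret cod: separated_scheme L\<^sub>2 U\<^sub>2 by fact
  have hU: "h ` U\<^sub>2 = U\<^sub>1"
    and ev: "\<And>u \<sigma>. \<lbrakk>u \<in> U\<^sub>2; \<sigma> \<in> carrier L\<^sub>1\<rbrakk> \<Longrightarrow> gen_ev L\<^sub>2 u (f \<sigma>) = gen_ev L\<^sub>1 (h u) \<sigma>"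
    using h by (auto simp: preserves_schemes_def)
  have fcl: "f \<sigma> \<in> carrier L\<^sub>2" if "\<sigma> \<in> carrier L\<^sub>1" for \<sigma>
    using f that by blast
  \<comment> \<open>The \<open>Yes\<close> and \<open>No\<close> values record the states above the
    first and second component, so the evaluation identity splits into two equivalences.\<close>
  have fst_le: "fst u \<sqsubseteq>\<^bsub>L\<^sub>2\<^esub> f \<sigma> \<longleftrightarrow> fst (h u) \<sqsubseteq>\<^bsub>L\<^sub>1\<^esub> \<sigma>"
    and snd_le: "snd u \<sqsubseteq>\<^bsub>L\<^sub>2\<^esub> f \<sigma> \<longleftrightarrow> snd (h u) \<sqsubseteq>\<^bsub>L\<^sub>1\<^esub> \<sigma>"
    if u: "u \<in> U\<^sub>2" and \<sigma>: "\<sigma> \<in> carrier L\<^sub>1" for u \<sigma>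
  proof -
    have hu: "h u \<in> U\<^sub>1" using hU u by blast
    show "fst u \<sqsubseteq>\<^bsub>L\<^sub>2\<^esub> f \<sigma> \<longleftrightarrow> fst (h u) \<sqsubseteq>\<^bsub>L\<^sub>1\<^esub> \<sigma>"
      unfolding gen_ev_Yes_iff[symmetric] ev[OF u \<sigma>] ..
    show "snd u \<sqsubseteq>\<^bsub>L\<^sub>2\<^esub> f \<sigma> \<longleftrightarrow> snd (h u) \<sqsubseteq>\<^bsub>L\<^sub>1\<^esub> \<sigma>"
      unfolding gen_ev_No_iff[OF cod.generalized[OF u] fcl[OF \<sigma>], symmetric]
        gen_ev_No_iff[OF dom.generalized[OF hu] \<sigma>, symmetric] ev[OF u \<sigma>] ..
  qed
  \<comment> \<open>Completeness gives a test with first component \<tau>; by \<open>fst_le\<close>,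
    the first component of its image under \<open>h\<close> is the least \<rho> with \<tau> below
    \<open>f \<rho>\<close>. Completeness excludes bottom, for which the bottom of the domain
    serves.\<close>
  have adjoint: "\<exists>\<rho>\<in>carrier L\<^sub>1. \<tau> \<sqsubseteq>\<^bsub>L\<^sub>2\<^esub> f \<rho> \<and>
      (\<forall>\<sigma>\<in>carrier L\<^sub>1. \<tau> \<sqsubseteq>\<^bsub>L\<^sub>2\<^esub> f \<sigma> \<longrightarrow> \<rho> \<sqsubseteq>\<^bsub>L\<^sub>1\<^esub> \<sigma>)" if \<tau>: "\<tau> \<in> carrier L\<^sub>2" for \<tau>
  proof (cases "\<tau> = \<bottom>\<^bsub>L\<^sub>2\<^esub>")
    case True
    then show ?thesis
      using fcl by (intro bexI[of _ "\<bottom>\<^bsub>L\<^sub>1\<^esub>"]) auto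
  next
    case False
    then obtain \<tau>' where u: "(\<tau>, \<tau>') \<in> U\<^sub>2" using cod.complete \<tau> by blast
    then have "h (\<tau>, \<tau>') \<in> U\<^sub>1" using hU by blast
    then have "fst (h (\<tau>, \<tau>')) \<in> carrier L\<^sub>1"
      using dom.test_closed(1)[of "fst (h (\<tau>, \<tau>'))" "snd (h (\<tau>, \<tau>'))"] by simp
    then show ?thesis
      using fst_le[OF u] by (intro bexI[of _ "fst (h (\<tau>, \<tau>'))"]) simp_all
  qed
  \<comment> \<open>A state above \<open>f \<sigma>\<close> lies below some \<open>f \<rho>\<close>.
    The embedding reflects this to \<sigma> below \<rho>, maximality gives \<rho> = \<sigma>, and
    the state is squeezed.\<close>
  have f_pure: "f \<sigma> \<in> pure L\<^sub>2" if \<sigma>: "\<sigma> \<in> pure L\<^sub>1" for \<sigma>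
  proof -
    have \<sigma>c: "\<sigma> \<in> carrier L\<^sub>1" using \<sigma> by (rule dom.pure_closed)
    have "\<tau> = f \<sigma>" if \<tau>: "\<tau> \<in> carrier L\<^sub>2" and le: "f \<sigma> \<sqsubseteq>\<^bsub>L\<^sub>2\<^esub> \<tau>" for \<tau>
    proof -
      obtain \<rho> where \<rho>: "\<rho> \<in> carrier L\<^sub>1" "\<tau> \<sqsubseteq>\<^bsub>L\<^sub>2\<^esub> f \<rho>" using adjoint[OF \<tau>] by blast
      then have "f \<sigma> \<sqsubseteq>\<^bsub>L\<^sub>2\<^esub> f \<rho>" using cod.le_trans[OF le] \<tau> fcl \<sigma>c by simp
      then have "\<rho> = \<sigma>" using emb[OF \<sigma>c \<rho>(1)] dom.pure_le_eq[OF \<sigma> \<rho>(1)] by simp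
      then show ?thesis using cod.le_antisym[OF _ le] \<rho> \<tau> fcl by simp
    qed
    then show ?thesis
      using \<sigma>c fcl by (auto simp: cod.pure_eq_maximal maximal_elements_def)
  qed
  \<comment> \<open>A maximal \<tau> below \<open>f \<rho>\<close> equals it. A state above \<rho>
    has image above \<tau>, hence the same image, so \<rho> is maximal too.\<close>
  have f_onto: "\<tau> \<in> f ` pure L\<^sub>1" if \<tau>: "\<tau> \<in> pure L\<^sub>2" for \<tau>
  proof -
    note \<tau>c = cod.pure_closed[OF \<tau>]
    obtain \<rho> where \<rho>: "\<rho> \<in> carrier L\<^sub>1" "\<tau> \<sqsubseteq>\<^bsub>L\<^sub>2\<^esub> f \<rho>" using adjoint[OF \<tau>c] by blast
    then have \<tau>\<rho>: "f \<rho> = \<tau>" using cod.pure_le_eq[OF \<tau>] fcl by simp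
    have "\<sigma> = \<rho>" if \<sigma>: "\<sigma> \<in> carrier L\<^sub>1" "\<rho> \<sqsubseteq>\<^bsub>L\<^sub>1\<^esub> \<sigma>" for \<sigma>
    proof -
      have "\<tau> \<sqsubseteq>\<^bsub>L\<^sub>2\<^esub> f \<sigma>" using emb[OF \<rho>(1) \<sigma>(1)] \<sigma>(2) \<tau>\<rho> by simp
      then have "f \<sigma> = \<tau>" using cod.pure_le_eq[OF \<tau> fcl[OF \<sigma>(1)]] by simp
      then have "\<sigma> \<sqsubseteq>\<^bsub>L\<^sub>1\<^esub> \<rho>" using emb[OF \<sigma>(1) \<rho>(1)] \<tau>\<rho> \<tau>c by simp
      then show ?thesis using dom.le_antisym[OF _ \<sigma>(2)] \<rho>(1) \<sigma>(1) by simp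
    qed
    then have "\<rho> \<in> pure L\<^sub>1"
      using \<rho>(1) by (auto simp: dom.pure_eq_maximal maximal_elements_def)
    then show ?thesis using \<tau>\<rho> by blast
  qed
  show ?thesis
  proof unfold_locales
    have "inj_on f (pure L\<^sub>1)"
    proof (rule inj_onI)
      fix \<sigma> \<tau> assume "\<sigma> \<in> pure L\<^sub>1" "\<tau> \<in> pure L\<^sub>1" "f \<sigma> = f \<tau>"
      then show "\<sigma> = \<tau>"
        using emb[of \<sigma> \<tau>] emb[of \<tau> \<sigma>] fcl[of \<tau>]
        by (simp add: dom.pure_closed dom.le_antisym)
    qed
    then show "bij_betw f (pure L\<^sub>1) (pure L\<^sub>2)"
      using f_pure f_onto by (auto simp: bij_betw_def)
    fix \<sigma> \<tau> assume "\<sigma> \<in> pure L\<^sub>1" "\<tau> \<in> pure L\<^sub>1"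
    then have c: "\<sigma> \<in> carrier L\<^sub>1" "\<tau> \<in> carrier L\<^sub>1" by (simp_all add: dom.pure_closed)
    \<comment> \<open>As \<open>h\<close> maps onto the first scheme, every witness there comes from
      one in the second, and both component conditions transfer.\<close>
    have "(\<exists>u\<in>U\<^sub>2. fst u \<sqsubseteq>\<^bsub>L\<^sub>2\<^esub> f \<sigma> \<and> snd u \<sqsubseteq>\<^bsub>L\<^sub>2\<^esub> f \<tau>) \<longleftrightarrow>
        (\<exists>u\<in>U\<^sub>1. fst u \<sqsubseteq>\<^bsub>L\<^sub>1\<^esub> \<sigma> \<and> snd u \<sqsubseteq>\<^bsub>L\<^sub>1\<^esub> \<tau>)"
      unfolding hU[symmetric] by (simp add: fst_le[OF _ c(1)] snd_le[OF _ c(2)] cong: bex_cong)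
    then show "orthogonal L\<^sub>2 U\<^sub>2 (f \<sigma>) (f \<tau>) \<longleftrightarrow> orthogonal L\<^sub>1 U\<^sub>1 \<sigma> \<tau>"
      unfolding dom.orthogonal_iff cod.orthogonal_iff case_prod_beta using c fcl by simp
  qed
qed

theorem theorem18:
  fixes M\<^sub>1 :: "('p, 't) test_system" and M\<^sub>2 :: "('q, 'u) test_system"
    and U\<^sub>1 :: "('p set \<times> 'p set) set" and U\<^sub>2 :: "('q set \<times> 'q set) set"
    and f :: "'p set \<Rightarrow> 'q set" and g :: "'u \<Rightarrow> 't" and h :: "'q set \<times> 'q set \<Rightarrow> 'p set \<times> 'p set"
  defines "S\<^sub>1 \<equiv> state_poset M\<^sub>1" and "S\<^sub>2 \<equiv> state_poset M\<^sub>2"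
  assumes "state_system M\<^sub>1" and "state_system M\<^sub>2"
    and "pure S\<^sub>1 \<subseteq> maximal_elements S\<^sub>1" and "pure S\<^sub>2 \<subseteq> maximal_elements S\<^sub>2"
    and "scheme S\<^sub>1 U\<^sub>1" and "\<forall>u\<in>U\<^sub>1. discriminating S\<^sub>1 u"
    and "scheme S\<^sub>2 U\<^sub>2" and "\<forall>u\<in>U\<^sub>2. discriminating S\<^sub>2 u"
    and "symmetry M\<^sub>1 M\<^sub>2 f g"
    and "preserves_schemes S\<^sub>1 U\<^sub>1 S\<^sub>2 U\<^sub>2 f h"
  shows "f \<in> pure S\<^sub>1 \<rightarrow> pure S\<^sub>2 \<and>
    inj_on (induced_map S\<^sub>2 U\<^sub>2 f) (carrier (closed_pure_sets S\<^sub>1 U\<^sub>1)) \<and>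
    ortho_morphism (closed_pure_sets S\<^sub>1 U\<^sub>1) (closed_pure_sets S\<^sub>2 U\<^sub>2) (induced_map S\<^sub>2 U\<^sub>2 f)"
proof -
  have "separated_scheme S\<^sub>1 U\<^sub>1" "separated_scheme S\<^sub>2 U\<^sub>2"
    using assms state_system_imp_separated_scheme unfolding S\<^sub>1_def S\<^sub>2_def by blast+
  moreover have "f \<in> carrier S\<^sub>1 \<rightarrow> carrier S\<^sub>2"
    using \<open>symmetry M\<^sub>1 M\<^sub>2 f g\<close> by (simp add: symmetry_def S\<^sub>1_def S\<^sub>2_def)
  moreover have "f \<sigma> \<sqsubseteq>\<^bsub>S\<^sub>2\<^esub> f \<tau> \<longleftrightarrow> \<sigma> \<sqsubseteq>\<^bsub>S\<^sub>1\<^esub> \<tau>" if "\<sigma> \<in> carrier S\<^sub>1" "\<tau> \<in> carrier S\<^sub>1" for \<sigma> \<tau>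
    using symmetry_le_iff[OF \<open>symmetry M\<^sub>1 M\<^sub>2 f g\<close>] that by (simp add: S\<^sub>1_def S\<^sub>2_def)
  ultimately interpret pure_state_isomorphism S\<^sub>1 U\<^sub>1 S\<^sub>2 U\<^sub>2 f
    using \<open>preserves_schemes S\<^sub>1 U\<^sub>1 S\<^sub>2 U\<^sub>2 f h\<close>
    by (rule pure_state_isomorphism_of_embedding)
  show ?thesis
    using image_pure inj_on_induced_map ortho_morphism_induced_map by blast
qed

end
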